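(* Let $F$ be a baseline distribution function and, for $\alpha\ge 0$, $\beta,\theta>0$, let $G_{\alpha,\beta,\theta}$ be the distribution function whose odds function is $$\Lambda_{G_{\alpha,\beta,\theta}}(x)=\beta\left((\alpha+\Lambda_F(x))^\theta-\alpha^\theta\right).$$ Then: 1. If $\theta\ge 1$ and $F$ has increasing odds rate, then $G_{\alpha,\beta,\theta}$ has increasing odds rate. 2. If $\theta\le 1$ and $F$ has decreasing odds rate, then $G_{\alpha,\beta,\theta}$ has decreasing odds rate.
   Context: The baseline $F$ is a distribution function on $\mathbb{R}$ with density $f$; $\overline F=1-F$. For a distribution function $H$ with density $h$, the odds function is $\Lambda_H=H/\overline H=1/\overline H-1$ (equal to $+\infty$ where $\overline H=0$) and the odds rate is $\lambda_H=\Lambda_H'=h/\overline H^2$. The density of $G_{\alpha,\beta,\theta}$ is $g_{\alpha,\beta,\theta}=\beta\theta(\alpha+\Lambda_F)^{\theta-1}\,\overline G_{\alpha,\beta,\theta}^2\, f/\overline F^2$, where $\overline G_{\alpha,\beta,\theta}=1-G_{\alpha,\beta,\theta}$. "Increasing" and "decreasing" are in the weak sense; monotonicity of odds rates is understood on the set where $0<F<1$ (the support). *)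

theory Defs
  imports "HOL-Probability.Probability"
begin

definition distribution_function :: "(real \<Rightarrow> real) \<Rightarrow> bool" where
  "distribution_function H \<longleftrightarrow> (\<exists>M. real_distribution M \<and> H = cdf M)"

definition has_density :: "(real \<Rightarrow> real) \<Rightarrow> (real \<Rightarrow> real) \<Rightarrow> bool" where
  "has_density H h \<longleftrightarrow>
     h \<in> borel_measurable borel \<and> (\<forall>x. 0 \<le> h x) \<and>
     real_distribution (density lborel (\<lambda>x. ennreal (h x))) \<and>
     H = cdf (density lborel (\<lambda>x. ennreal (h x)))"

definition odds :: "(real \<Rightarrow> real) \<Rightarrow> real \<Rightarrow> ereal" where
  "odds H x = (if 1 - H x = 0 then \<infinity> else ereal (H x / (1 - H x)))"

text \<open>Densities are determined only almost everywhere, so the odds rate, and hence its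
  monotonicity, refers to a distribution function together with a chosen density.\<close>

definition odds_rate :: "(real \<Rightarrow> real) \<Rightarrow> (real \<Rightarrow> real) \<Rightarrow> real \<Rightarrow> real" where
  "odds_rate H h x = h x / (1 - H x)\<^sup>2"

definition increasing_odds_rate :: "(real \<Rightarrow> real) \<Rightarrow> (real \<Rightarrow> real) \<Rightarrow> bool" where
  "increasing_odds_rate H h \<longleftrightarrow>
     has_density H h \<and> mono_on {x. 0 < H x \<and> H x < 1} (odds_rate H h)"

definition decreasing_odds_rate :: "(real \<Rightarrow> real) \<Rightarrow> (real \<Rightarrow> real) \<Rightarrow> bool" where
  "decreasing_odds_rate H h \<longleftrightarrow>
     has_density H h \<and> antimono_on {x. 0 < H x \<and> H x < 1} (odds_rate H h)"

text \<open>Powers with a positive real exponent on the extended half-line from 0 to \<open>\<infinity>\<close>;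
  nothing else is used.\<close>

definition ereal_powr :: "ereal \<Rightarrow> real \<Rightarrow> ereal" where
  "ereal_powr y p = (if y = \<infinity> then \<infinity> else ereal (real_of_ereal y powr p))"

definition transformed_odds :: "real \<Rightarrow> real \<Rightarrow> real \<Rightarrow> (real \<Rightarrow> real) \<Rightarrow> real \<Rightarrow> ereal" where
  "transformed_odds \<alpha> \<beta> \<theta> F x =
     ereal \<beta> * (ereal_powr (ereal \<alpha> + odds F x) \<theta> - ereal (\<alpha> powr \<theta>))"

text \<open>The density of the distribution function \<open>G\<close> whose odds function is
  \<open>transformed_odds \<alpha> \<beta> \<theta> F\<close>, for a given density \<open>f\<close> of \<open>F\<close>. Off the set where
  \<open>0 < F < 1\<close>, which carries all the mass, the formula is subject to the conventions
  \<open>y / 0 = 0\<close>, \<open>0 powr p = 0\<close> and \<open>real_of_ereal \<infinity> = 0\<close>; the value is \<open>0\<close> wherever \<open>F = 1\<close>.\<close>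

definition transformed_density ::
  "real \<Rightarrow> real \<Rightarrow> real \<Rightarrow> (real \<Rightarrow> real) \<Rightarrow> (real \<Rightarrow> real) \<Rightarrow> (real \<Rightarrow> real) \<Rightarrow> real \<Rightarrow> real" where
  "transformed_density \<alpha> \<beta> \<theta> F f G x =
     \<beta> * \<theta> * (\<alpha> + real_of_ereal (odds F x)) powr (\<theta> - 1) * (1 - G x)\<^sup>2 * (f x / (1 - F x)\<^sup>2)"

end

theory Submission
  imports Defs "HOL-Real_Asymp.Real_Asymp"
begin

text \<open>On the support, the odds rate of \<open>G\<close> is \<open>\<beta>\<theta>(\<alpha> + \<Lambda>\<^sub>F)\<^bsup>\<theta>-1\<^esup> \<lambda>\<^sub>F\<close>, a product of two
  nonnegative factors that are monotone in the same direction. The remaining point is that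
  \<open>G\<close> is absolutely continuous with the stated density. For this, write \<open>G = \<phi> \<circ> F\<close> with
  \<open>\<phi>\<close> continuously differentiable on the open unit interval only. Since \<open>F\<close> need not be
  differentiable, no pointwise chain rule is used: \<open>F\<close> maps its own distribution to the
  uniform one, which turns the integral of \<open>(\<phi>' \<circ> F) f\<close> into an integral of \<open>\<phi>'\<close>.\<close>

section \<open>The probability integral transform\<close>

text \<open>For \<open>u < 1\<close> a nonempty sublevel set is bounded above, and continuity makes
  it closed. It is therefore a ray \<open>{..y}\<close>, whose mass is
  \<open>cdf M y = u\<close>.\<close>

lemma (in real_distribution) measure_cdf_le:
  assumes cont: "\<And>x. isCont (cdf M) x"
  shows "measure M {t. cdf M t \<le> u} = min 1 (max 0 u)"
proof -
  let ?S = "{t. cdf M t \<le> u}"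
  consider "u \<ge> 1" | "u < 1" "?S = {}" | "u < 1" "?S \<noteq> {}" by linarith
  then show ?thesis
  proof cases
    case 1
    then have "?S = UNIV"
      using cdf_bounded_prob by (auto intro: order_trans)
    then show ?thesis
      using 1 prob_space by simp
  next
    case 2
    \<comment> \<open>An empty sublevel set leaves no room for \<open>u > 0\<close>, because the cdf
      tends to 0 at minus infinity.\<close>
    have "u \<le> 0"
    proof (rule ccontr)
      assume "\<not> u \<le> 0"
      then have "eventually (\<lambda>t. cdf M t < u) at_bot"
        by (intro order_tendstoD(2)[OF cdf_lim_at_bot]) auto
      then obtain t where "cdf M t < u"
        by (metis eventually_at_bot_linorder order_refl)
      then show False
        using 2(2) by (metis (mono_tags, lifting) empty_iff less_imp_le mem_Collect_eq)
    qed
    then show ?thesis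
      using 2 by simp
  next
    case 3
    have "eventually (\<lambda>t. u < cdf M t) at_top"
      using 3 by (intro order_tendstoD(1)[OF cdf_lim_at_top_prob])
    then obtain b where b: "\<And>t. t \<ge> b \<Longrightarrow> u < cdf M t"
      by (auto simp: eventually_at_top_linorder)
    have bdd: "bdd_above ?S"
    proof (rule bdd_aboveI)
      fix t assume "t \<in> ?S"
      then show "t \<le> b"
        using b[of t] by (cases "t \<le> b") auto
    qed
    have closed: "closed ?S"
      using cont by (intro closed_Collect_le continuous_on_const continuous_at_imp_continuous_on) auto
    define y where "y = Sup ?S"
    have yS: "y \<in> ?S"
      unfolding y_def using closed_contains_Sup[OF 3(2) bdd closed] .
    have le: "t \<le> y" if "t \<in> ?S" for t
      unfolding y_def using that bdd by (rule cSup_upper)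
    have S: "?S = {..y}"
    proof safe
      fix t assume "cdf M t \<le> u"
      then show "t \<le> y" using le by auto
    next
      fix t assume "t \<le> y"
      then show "cdf M t \<le> u"
        using yS cdf_nondecreasing[of t y] by auto
    qed
    \<comment> \<open>If \<open>cdf M y < u\<close>, right continuity would put some
      \<open>t > y\<close> into the sublevel set, against the choice of \<open>y\<close> as its
      supremum.\<close>
    have "u \<le> cdf M y"
    proof (rule ccontr)
      assume "\<not> u \<le> cdf M y"
      then have "eventually (\<lambda>t. cdf M t < u) (at_right y)"
        by (intro order_tendstoD(2)[OF cdf_is_right_cont[unfolded continuous_within]]) auto
      then have "eventually (\<lambda>t. cdf M t < u \<and> y < t) (at_right y)"
        by (intro eventually_conj eventually_at_right_less)
      then obtain t where "cdf M t < u" "y < t"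
        using eventually_happens' trivial_limit_at_right_real by (metis (lifting))
      then show False
        using le[of t] by auto
    qed
    then have "cdf M y = u"
      using yS by auto
    then show ?thesis
      using S 3 cdf_nonneg[of y] by (simp add: cdf_def2 min_def)
  qed
qed

lemma (in real_distribution) borel_measurable_cdf: "cdf M \<in> borel_measurable borel"
  by (intro borel_measurable_mono monoI cdf_nondecreasing)

text \<open>Both laws have the distribution function \<open>min 1 (max 0 u)\<close>, and a
  distribution function determines its law.\<close>

lemma (in real_distribution) distr_cdf_uniform:
  assumes cont: "\<And>x. isCont (cdf M) x"
  shows "distr M borel (cdf M) = uniform_measure lborel {0..1}"
proof (rule cdf_unique)
  have meas: "cdf M \<in> borel_measurable M"
    using borel_measurable_cdf by simp
  show "real_distribution (distr M borel (cdf M))"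
    using meas by (rule real_distribution_distr)
  show "real_distribution (uniform_measure lborel {0..1::real})"
    by (auto simp: real_distribution_def real_distribution_axioms_def
        intro!: prob_space_uniform_measure)
  show "cdf (distr M borel (cdf M)) = cdf (uniform_measure lborel {0..1})"
  proof
    fix u :: real
    have "cdf (distr M borel (cdf M)) u = measure M {t. cdf M t \<le> u}"
      by (simp add: cdf_def[of "distr M borel (cdf M)"] measure_distr[OF meas] vimage_def)
    also have "\<dots> = min 1 (max 0 u)"
      by (rule measure_cdf_le[OF cont])
    \<comment> \<open>For negative \<open>u\<close> the interval is empty, which matches the
      truncation at 0.\<close>
    also have "\<dots> = measure lborel {0..min 1 u}"
      by auto
    also have "{0..min 1 u} = {0..1} \<inter> {..u}"
      by auto
    also have "measure lborel \<dots> = cdf (uniform_measure lborel {0..1}) u"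
      unfolding cdf_def by (subst measure_uniform_measure) auto
    finally show "cdf (distr M borel (cdf M)) u = cdf (uniform_measure lborel {0..1}) u" .
  qed
qed

text \<open>A law with a Lebesgue density has no atoms, and a cdf is continuous exactly at the
  points that are not atoms.\<close>

lemma isCont_cdf_density:
  assumes "f \<in> borel_measurable borel"
    and "real_distribution (density lborel (\<lambda>x. ennreal (f x)))"
  shows "isCont (cdf (density lborel (\<lambda>x. ennreal (f x)))) x"
proof -
  interpret real_distribution "density lborel (\<lambda>x. ennreal (f x))" by fact
  have "{x} \<in> null_sets (density lborel (\<lambda>x. ennreal (f x)))"
    using assms(1) by (subst null_sets_density_iff)
      (auto intro!: eventually_mono[OF AE_lborel_singleton[of x]] simp del: eventually_frequently_simps)
  then show ?thesis
    unfolding isCont_cdf by (auto simp: measure_def null_sets_def)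
qed

section \<open>Composition with a function smooth on the open unit interval\<close>

text \<open>The derivative may be unbounded at the end points: in the application with \<theta> < 1
  it blows up at 1, and also at 0 if \<alpha> = 0. One-sided limits of \<phi> therefore replace its
  values there, and the nonnegativity of \<psi> yields integrability.\<close>

lemma nn_integral_FTC_open:
  fixes \<phi> \<psi> :: "real \<Rightarrow> real"
  assumes "a < b"
    and deriv: "\<And>u. a < u \<Longrightarrow> u < b \<Longrightarrow> (\<phi> has_real_derivative \<psi> u) (at u)"
    and cont: "\<And>u. a < u \<Longrightarrow> u < b \<Longrightarrow> isCont \<psi> u"
    and nonneg: "\<And>u. 0 \<le> \<psi> u"
    and lims: "(\<phi> \<longlongrightarrow> A) (at_right a)" "(\<phi> \<longlongrightarrow> B) (at_left b)"
  shows "(\<integral>\<^sup>+u. ennreal (\<psi> u) * indicator {a..b} u \<partial>lborel) = ennreal (B - A)"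
proof -
  have I: "set_integrable lborel {a<..<b} \<psi>" "(LBINT x=a..b. \<psi> x) = B - A"
    using interval_integral_FTC_nonneg[of "ereal a" "ereal b" \<phi> \<psi> A B] assms
    by (auto simp: ereal_tendsto_simps)
  have "(\<integral>\<^sup>+u. ennreal (\<psi> u) * indicator {a..b} u \<partial>lborel)
      = (\<integral>\<^sup>+u. ennreal (indicator {a<..<b} u *\<^sub>R \<psi> u) \<partial>lborel)"
    using AE_lborel_singleton[of a] AE_lborel_singleton[of b]
    by (intro nn_integral_cong_AE) (auto split: split_indicator)
  also have "\<dots> = ennreal (LBINT x:{a<..<b}. \<psi> x)"
    unfolding set_lebesgue_integral_def using I(1) nonneg
    by (intro nn_integral_eq_integral) (auto simp: set_integrable_def)
  also have "(LBINT x:{a<..<b}. \<psi> x) = B - A"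
    using I(2) \<open>a < b\<close> by (simp add: interval_lebesgue_integral_def)
  finally show ?thesis .
qed

text \<open>Relative to the law \<open>M\<close> of \<open>F\<close>, the candidate law
  \<open>N\<close> has density \<open>\<psi> (F x)\<close>. Once the event \<open>x \<le> y\<close>
  is expressed through \<open>F x\<close>, the whole integrand depends on \<open>F x\<close> alone
  and moves to the unit interval, where it integrates to \<open>\<phi> (F y)\<close>.\<close>

lemma has_density_compose:
  fixes F f \<phi> \<psi> :: "real \<Rightarrow> real"
  assumes F: "has_density F f"
    and [measurable]: "\<psi> \<in> borel_measurable borel"
    and nonneg: "\<And>u. 0 \<le> \<psi> u"
    and deriv: "\<And>u. 0 < u \<Longrightarrow> u < 1 \<Longrightarrow> (\<phi> has_real_derivative \<psi> u) (at u)"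
    and cont: "\<And>u. 0 < u \<Longrightarrow> u < 1 \<Longrightarrow> isCont \<psi> u"
    and end0: "\<phi> 0 = 0" "(\<phi> \<longlongrightarrow> 0) (at_right 0)"
    and end1: "\<phi> 1 = 1" "(\<phi> \<longlongrightarrow> 1) (at_left 1)"
  shows "has_density (\<lambda>x. \<phi> (F x)) (\<lambda>x. \<psi> (F x) * f x)"
proof -
  define M where "M = density lborel (\<lambda>x. ennreal (f x))"
  have [measurable]: "f \<in> borel_measurable borel" and f_nonneg: "\<And>x. 0 \<le> f x"
    and M: "real_distribution M" and FM: "F = cdf M"
    using F by (auto simp: has_density_def M_def)
  interpret real_distribution M by (rule M)
  have [measurable]: "F \<in> borel_measurable borel"
    unfolding FM by (rule borel_measurable_cdf)
  have F01: "0 \<le> F x" "F x \<le> 1" for x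
    unfolding FM by (auto simp: cdf_nonneg cdf_bounded_prob)
  have contF: "isCont (cdf M) x" for x
    using isCont_cdf_density M by (auto simp: M_def)
  have unif: "distr M borel F = uniform_measure lborel {0..1}"
    unfolding FM using contF by (rule distr_cdf_uniform)
  define N where "N = density lborel (\<lambda>x. ennreal (\<psi> (F x) * f x))"
  have N: "N = density M (\<lambda>x. ennreal (\<psi> (F x)))"
    unfolding N_def M_def using nonneg f_nonneg
    by (subst density_density_eq) (auto simp: ennreal_mult' mult.commute)

  have eq: "{x. F x \<le> F y} = {..y} \<union> {x. y < x \<and> F x = F y}" for y
    unfolding FM using cdf_nondecreasing by (force simp: antisym)
  \<comment> \<open>\<open>F\<close> may be flat to the right of \<open>y\<close>. The flat stretch
    is a null set, since adding it to \<open>{..y}\<close> leaves the mass at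
    \<open>F y\<close>.\<close>
  have AE: "AE x in M. x \<le> y \<longleftrightarrow> F x \<le> F y" for y
  proof -
    have "measure M {x. F x \<le> F y} = F y"
      using measure_cdf_le[OF contF, of "F y"] F01[of y] by (simp add: FM[symmetric])
    also have "F y = measure M {..y}"
      by (simp add: FM cdf_def2)
    finally have "measure M {x. F x \<le> F y} = measure M {..y}" .
    moreover have "measure M {x. F x \<le> F y} = measure M {..y} + measure M {x. y < x \<and> F x = F y}"
      unfolding eq by (rule finite_measure_Union) auto
    ultimately have "measure M {x. y < x \<and> F x = F y} = 0"
      by simp
    then have "{x. y < x \<and> F x = F y} \<in> null_sets M"
      by (auto simp: null_sets_def emeasure_eq_measure)
    then show ?thesis
      by (rule AE_I') (use eq[of y] in auto)
  qed

  have int: "(\<integral>\<^sup>+x. ennreal (\<psi> (F x)) * indicator {..c} (F x) \<partial>M) = ennreal (\<phi> c)"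
    if c: "0 \<le> c" "c \<le> 1" for c
  proof -
    have "(\<integral>\<^sup>+x. ennreal (\<psi> (F x)) * indicator {..c} (F x) \<partial>M)
        = (\<integral>\<^sup>+u. ennreal (\<psi> u) * indicator {..c} u \<partial>distr M borel F)"
      by (subst nn_integral_distr) auto
    also have "\<dots> = (\<integral>\<^sup>+u. ennreal (\<psi> u) * indicator {..c} u * indicator {0..1} u \<partial>lborel)"
      unfolding unif by (subst nn_integral_uniform_measure) (auto simp: divide_ennreal_def)
    also have "\<dots> = (\<integral>\<^sup>+u. ennreal (\<psi> u) * indicator {0..c} u \<partial>lborel)"
      using c by (intro nn_integral_cong) (auto split: split_indicator)
    also have "\<dots> = ennreal (\<phi> c)"
    \<comment> \<open>The fundamental theorem is stated for a nondegenerate interval; at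
      \<open>c = 0\<close> the integral is over a single point.\<close>
    proof (cases "c = 0")
      case True
      then have "(\<integral>\<^sup>+u. ennreal (\<psi> u) * indicator {0..c} u \<partial>lborel) = (\<integral>\<^sup>+u. 0 \<partial>(lborel :: real measure))"
        by (intro nn_integral_cong_AE eventually_mono[OF AE_lborel_singleton[of "0::real"]])
          (auto split: split_indicator)
      then show ?thesis
        using True end0 by simp
    next
      case False
      \<comment> \<open>Inside the interval this is differentiability; at 1 only the assumed left
        limit is available.\<close>
      have "(\<phi> \<longlongrightarrow> \<phi> c) (at_left c)"
      proof (cases "c = 1")
        case False
        then have "isCont \<phi> c"
          using deriv[of c] c \<open>c \<noteq> 0\<close> DERIV_isCont by fastforce
        then show ?thesis
          unfolding isCont_def by (rule filterlim_mono[OF _ order_refl at_le]) simp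
      qed (use end1 in simp)
      then show ?thesis
        using nn_integral_FTC_open[of 0 c \<phi> \<psi> 0 "\<phi> c"] False c deriv cont nonneg end0 by simp
    qed
    finally show ?thesis .
  qed

  \<comment> \<open>Since \<open>ennreal\<close> sends negative numbers to 0, the value
    \<open>\<phi> (F y)\<close> can be read off the integral only when it is nonnegative. This holds
    because \<phi> is nondecreasing on the open interval and tends to 0 at its left end.\<close>
  have \<phi>_nonneg: "0 \<le> \<phi> (F y)" for y
  proof (cases "F y = 0 \<or> F y = 1")
    case False
    then have Fy: "0 < F y" "F y < 1"
      using F01[of y] by linarith+
    have "eventually (\<lambda>u. \<phi> u \<le> \<phi> (F y)) (at_right 0)"
      unfolding eventually_at_right[OF zero_less_one]
    proof (intro exI conjI allI impI)
      show "0 < F y" by fact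
      fix u assume u: "0 < u" "u < F y"
      show "\<phi> u \<le> \<phi> (F y)"
      proof (rule DERIV_nonneg_imp_nondecreasing[of u "F y" \<phi>])
        fix v assume "u \<le> v" "v \<le> F y"
        then show "\<exists>d. (\<phi> has_real_derivative d) (at v) \<and> 0 \<le> d"
          using u Fy by (intro exI[of _ "\<psi> v"] conjI deriv nonneg) auto
      qed (use u in simp)
    qed
    then show ?thesis
      using end0(2) by (intro tendsto_upperbound[of \<phi> 0 "at_right 0"]) auto
  qed (auto simp: end0 end1)

  have cdfN: "cdf N y = \<phi> (F y)" for y
  proof -
    have "emeasure N {..y} = (\<integral>\<^sup>+x. ennreal (\<psi> (F x)) * indicator {..y} x \<partial>M)"
      unfolding N by (subst emeasure_density) auto
    also have "\<dots> = (\<integral>\<^sup>+x. ennreal (\<psi> (F x)) * indicator {..F y} (F x) \<partial>M)"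
      using AE[of y] by (intro nn_integral_cong_AE) (auto split: split_indicator)
    also have "\<dots> = ennreal (\<phi> (F y))"
      using F01 by (rule int)
    finally show ?thesis
      using \<phi>_nonneg[of y] by (simp add: cdf_def measure_def)
  qed

  have "emeasure N UNIV = (\<integral>\<^sup>+x. ennreal (\<psi> (F x)) * indicator {..1} (F x) \<partial>M)"
    unfolding N using F01 by (subst emeasure_density) (auto intro!: nn_integral_cong)
  also have "\<dots> = 1"
    using int[of 1] end1 by simp
  finally have "prob_space N"
    by (intro prob_spaceI) (simp add: N_def)
  then have "real_distribution N"
    by (simp add: real_distribution_def real_distribution_axioms_def N_def)
  then show ?thesis
    unfolding has_density_def using nonneg f_nonneg cdfN by (auto simp: N_def)
qed

section \<open>The odds transform\<close>

text \<open>This is the function \<phi> with \<open>G = \<phi> \<circ> F\<close>, obtained by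
  inverting the odds as \<open>1 - 1 / (1 + L)\<close>. The case \<open>u = 1\<close> is separate
  because division by zero would give the value 0 there.\<close>

definition odds_link :: "real \<Rightarrow> real \<Rightarrow> real \<Rightarrow> real \<Rightarrow> real" where
  "odds_link \<alpha> \<beta> \<theta> u =
     (if u = 1 then 1 else 1 - 1 / (1 + \<beta> * ((\<alpha> + u / (1 - u)) powr \<theta> - \<alpha> powr \<theta>)))"

text \<open>At \<open>u = 1\<close> the value is \<open>0\<close>, because of the division by \<open>(1 - u)\<^sup>2\<close>.\<close>

definition odds_link_deriv :: "real \<Rightarrow> real \<Rightarrow> real \<Rightarrow> real \<Rightarrow> real" where
  "odds_link_deriv \<alpha> \<beta> \<theta> u =
     \<beta> * \<theta> * (\<alpha> + u / (1 - u)) powr (\<theta> - 1) * (1 - odds_link \<alpha> \<beta> \<theta> u)\<^sup>2 / (1 - u)\<^sup>2"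

context
  fixes \<alpha> \<beta> \<theta> :: real
  assumes \<alpha>: "\<alpha> \<ge> 0" and \<beta>: "\<beta> > 0" and \<theta>: "\<theta> > 0"
begin

section \<open>Smoothness of the link on the open unit interval\<close>

lemma odds_link_denominator_pos:
  assumes "0 \<le> u" "u < 1"
  shows "1 + \<beta> * ((\<alpha> + u / (1 - u)) powr \<theta> - \<alpha> powr \<theta>) > 0"
proof -
  have "\<alpha> powr \<theta> \<le> (\<alpha> + u / (1 - u)) powr \<theta>"
    using assms \<alpha> \<theta> by (intro powr_mono2) auto
  then show ?thesis
    using \<beta> by (intro add_pos_nonneg mult_nonneg_nonneg) auto
qed

lemma odds_link_has_derivative:
  assumes u: "0 < u" "u < 1"
  shows "(odds_link \<alpha> \<beta> \<theta> has_real_derivative odds_link_deriv \<alpha> \<beta> \<theta> u) (at u)"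
proof -
  let ?D = "\<lambda>u. 1 + \<beta> * ((\<alpha> + u / (1 - u)) powr \<theta> - \<alpha> powr \<theta>)"
  have pos: "\<alpha> + u / (1 - u) > 0"
    using u \<alpha> by (intro add_nonneg_pos) auto
  have "((\<lambda>u. u / (1 - u)) has_real_derivative 1 / (1 - u)\<^sup>2) (at u)"
    using u by (auto intro!: derivative_eq_intros simp: field_simps power2_eq_square)
  then have "((\<lambda>u. \<alpha> + u / (1 - u)) has_real_derivative 1 / (1 - u)\<^sup>2) (at u)"
    using DERIV_add[OF DERIV_const[of \<alpha>]] by fastforce
  from DERIV_fun_powr[OF this pos, of \<theta>]
  have "((\<lambda>u. (\<alpha> + u / (1 - u)) powr \<theta>) has_real_derivative
      \<theta> * (\<alpha> + u / (1 - u)) powr (\<theta> - 1) / (1 - u)\<^sup>2) (at u)"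
    by simp
  from DERIV_add[OF DERIV_const DERIV_cmult[OF DERIV_diff[OF this DERIV_const]]]
  have D: "(?D has_real_derivative
      \<beta> * \<theta> * (\<alpha> + u / (1 - u)) powr (\<theta> - 1) / (1 - u)\<^sup>2) (at u)"
    by (simp add: mult.assoc)
  have "((\<lambda>u. 1 - 1 / ?D u) has_real_derivative
      (\<beta> * \<theta> * (\<alpha> + u / (1 - u)) powr (\<theta> - 1) / (1 - u)\<^sup>2) / (?D u)\<^sup>2) (at u)"
    using DERIV_diff[OF DERIV_const[of 1] DERIV_divide[OF DERIV_const[of 1] D]]
      odds_link_denominator_pos[of u] u by (simp add: power2_eq_square)
  \<comment> \<open>The reciprocal of \<open>?D u\<close> is one minus the link, which accounts for
    the squared factor in \<open>odds_link_deriv\<close>.\<close>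
  moreover have "(\<beta> * \<theta> * (\<alpha> + u / (1 - u)) powr (\<theta> - 1) / (1 - u)\<^sup>2) / (?D u)\<^sup>2
      = odds_link_deriv \<alpha> \<beta> \<theta> u"
    using u by (simp add: odds_link_deriv_def odds_link_def power_divide)
  ultimately have "((\<lambda>u. 1 - 1 / ?D u) has_real_derivative odds_link_deriv \<alpha> \<beta> \<theta> u) (at u)"
    by simp
  moreover have "eventually (\<lambda>u. u \<in> {0<..<1}) (nhds u)"
    using u by (intro eventually_nhds_in_open) auto
  then have "eventually (\<lambda>u. 1 - 1 / ?D u = odds_link \<alpha> \<beta> \<theta> u) (nhds u)"
    by eventually_elim (auto simp: odds_link_def)
  ultimately show ?thesis
    by (subst DERIV_cong_ev[OF refl _ refl]) (auto simp: eq_commute)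
qed

lemma isCont_odds_link_deriv:
  assumes u: "0 < u" "u < 1"
  shows "isCont (odds_link_deriv \<alpha> \<beta> \<theta>) u"
proof -
  have "isCont (odds_link \<alpha> \<beta> \<theta>) u"
    using odds_link_has_derivative[OF u] by (rule DERIV_isCont)
  moreover have "\<alpha> + u / (1 - u) > 0"
    using u \<alpha> by (intro add_nonneg_pos) auto
  ultimately show ?thesis
    unfolding odds_link_deriv_def using u by (intro continuous_intros) auto
qed

lemma odds_link_deriv_nonneg: "0 \<le> odds_link_deriv \<alpha> \<beta> \<theta> u"
  unfolding odds_link_deriv_def using \<beta> \<theta> by simp

lemma borel_measurable_odds_link_deriv: "odds_link_deriv \<alpha> \<beta> \<theta> \<in> borel_measurable borel"
  unfolding odds_link_deriv_def odds_link_def by measurable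

section \<open>Values and limits of the link\<close>

lemma odds_link_0: "odds_link \<alpha> \<beta> \<theta> 0 = 0"
  by (simp add: odds_link_def)

lemma odds_link_1: "odds_link \<alpha> \<beta> \<theta> 1 = 1"
  by (simp add: odds_link_def)

lemma tendsto_odds_link_0: "(odds_link \<alpha> \<beta> \<theta> \<longlongrightarrow> 0) (at_right 0)"
proof -
  have ev: "eventually (\<lambda>u. u \<in> {0<..<1::real}) (at_right 0)"
    by (rule eventually_at_right_real) simp
  have "((\<lambda>u::real. \<alpha> + u / (1 - u)) \<longlongrightarrow> \<alpha> + 0 / (1 - 0)) (at_right 0)"
    by (intro tendsto_intros) auto
  then have "((\<lambda>u::real. \<alpha> + u / (1 - u)) \<longlongrightarrow> \<alpha>) (at_right 0)"
    by simp
  moreover have "eventually (\<lambda>u. 0 \<le> \<alpha> + u / (1 - u)) (at_right 0)"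
    using ev by eventually_elim (use \<alpha> in auto)
  \<comment> \<open>If \<alpha> = 0 the base tends to 0; the power is still continuous there from
    the nonnegative side because \<theta> > 0.\<close>
  ultimately have "((\<lambda>u. (\<alpha> + u / (1 - u)) powr \<theta>) \<longlongrightarrow> \<alpha> powr \<theta>) (at_right 0)"
    using \<theta> by (intro tendsto_powr') auto
  then have "((\<lambda>u. 1 - 1 / (1 + \<beta> * ((\<alpha> + u / (1 - u)) powr \<theta> - \<alpha> powr \<theta>)))
      \<longlongrightarrow> 1 - 1 / (1 + \<beta> * (\<alpha> powr \<theta> - \<alpha> powr \<theta>))) (at_right 0)"
    by (intro tendsto_diff tendsto_divide tendsto_add tendsto_mult tendsto_const) auto
  then have "((\<lambda>u. 1 - 1 / (1 + \<beta> * ((\<alpha> + u / (1 - u)) powr \<theta> - \<alpha> powr \<theta>)))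
      \<longlongrightarrow> 0) (at_right 0)"
    by simp
  moreover have "eventually (\<lambda>u. 1 - 1 / (1 + \<beta> * ((\<alpha> + u / (1 - u)) powr \<theta> - \<alpha> powr \<theta>))
      = odds_link \<alpha> \<beta> \<theta> u) (at_right 0)"
    using ev by eventually_elim (auto simp: odds_link_def)
  ultimately show ?thesis
    by (rule Lim_transform_eventually)
qed

lemma tendsto_odds_link_1: "(odds_link \<alpha> \<beta> \<theta> \<longlongrightarrow> 1) (at_left 1)"
proof -
  \<comment> \<open>Only the constancy of this term matters: the substitution
    \<open>y = \<alpha> + u / (1 - u)\<close> turns the left limit at 1 into a limit at
    infinity.\<close>
  define c where "c = \<alpha> powr \<theta>"
  have "((\<lambda>y. 1 - 1 / (1 + \<beta> * (y powr \<theta> - c))) \<longlongrightarrow> 1) at_top"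
    using \<beta> \<theta> by real_asymp
  moreover have "filterlim (\<lambda>u. \<alpha> + u / (1 - u)) at_top (at_left 1)"
    by real_asymp
  ultimately have "((\<lambda>u. 1 - 1 / (1 + \<beta> * ((\<alpha> + u / (1 - u)) powr \<theta> - c))) \<longlongrightarrow> 1) (at_left 1)"
    by (rule filterlim_compose)
  moreover have "eventually (\<lambda>u. 1 - 1 / (1 + \<beta> * ((\<alpha> + u / (1 - u)) powr \<theta> - c))
      = odds_link \<alpha> \<beta> \<theta> u) (at_left 1)"
    using eventually_at_left_real[OF zero_less_one]
    by eventually_elim (auto simp: odds_link_def c_def)
  ultimately show ?thesis
    by (rule Lim_transform_eventually)
qed

lemma odds_link_bounds:
  assumes "0 < u" "u < 1"
  shows "0 < odds_link \<alpha> \<beta> \<theta> u" "odds_link \<alpha> \<beta> \<theta> u < 1"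
proof -
  have "\<alpha> powr \<theta> < (\<alpha> + u / (1 - u)) powr \<theta>"
    using assms \<alpha> \<theta> by (intro powr_less_mono2) auto
  then have "\<beta> * ((\<alpha> + u / (1 - u)) powr \<theta> - \<alpha> powr \<theta>) > 0"
    using \<beta> by simp
  then show "0 < odds_link \<alpha> \<beta> \<theta> u" "odds_link \<alpha> \<beta> \<theta> u < 1"
    using assms by (auto simp: odds_link_def field_simps)
qed

section \<open>From odds functions to distribution functions and densities\<close>

text \<open>Odds determine the distribution function pointwise: infinite odds mean the value 1, and
  finite odds \<open>L\<close> mean \<open>1 - 1 / (1 + L)\<close>.\<close>

lemma odds_eq_transformed_odds_imp_link:
  assumes eq: "odds G x = transformed_odds \<alpha> \<beta> \<theta> F x"
  shows "G x = odds_link \<alpha> \<beta> \<theta> (F x)"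
proof (cases "F x = 1")
  case True
  then have "odds G x = \<infinity>"
    using eq \<beta> by (simp add: transformed_odds_def odds_def ereal_powr_def)
  then show ?thesis
    using True by (simp add: odds_def odds_link_def split: if_splits)
next
  case False
  define L where "L = \<beta> * ((\<alpha> + F x / (1 - F x)) powr \<theta> - \<alpha> powr \<theta>)"
  have "odds G x = ereal L"
    using False eq by (simp add: transformed_odds_def odds_def ereal_powr_def L_def)
  then have "1 - G x \<noteq> 0" "G x / (1 - G x) = L"
    by (auto simp: odds_def split: if_splits)
  then have "1 + L = 1 / (1 - G x)"
    by (auto simp: field_simps)
  then have "G x = 1 - 1 / (1 + L)"
    by simp
  then show ?thesis
    using False by (simp add: odds_link_def L_def)
qed

text \<open>Where \<open>F x = 1\<close> both sides vanish through division by zero, so the equality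
  holds at every point and not just almost everywhere.\<close>

lemma transformed_density_eq_link_deriv:
  assumes "G x = odds_link \<alpha> \<beta> \<theta> (F x)"
  shows "transformed_density \<alpha> \<beta> \<theta> F f G x = odds_link_deriv \<alpha> \<beta> \<theta> (F x) * f x"
  using assms by (auto simp: transformed_density_def odds_link_deriv_def odds_def)

lemma has_density_transformed:
  assumes "has_density F f" and "\<And>x. G x = odds_link \<alpha> \<beta> \<theta> (F x)"
  shows "has_density G (transformed_density \<alpha> \<beta> \<theta> F f G)"
proof -
  have "has_density (\<lambda>x. odds_link \<alpha> \<beta> \<theta> (F x)) (\<lambda>x. odds_link_deriv \<alpha> \<beta> \<theta> (F x) * f x)"
    using assms(1) by (intro has_density_compose borel_measurable_odds_link_deriv
        odds_link_deriv_nonneg odds_link_has_derivative isCont_odds_link_deriv odds_link_0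
        tendsto_odds_link_0 odds_link_1 tendsto_odds_link_1)
  moreover have "G = (\<lambda>x. odds_link \<alpha> \<beta> \<theta> (F x))"
    using assms(2) by auto
  moreover have "transformed_density \<alpha> \<beta> \<theta> F f G = (\<lambda>x. odds_link_deriv \<alpha> \<beta> \<theta> (F x) * f x)"
    using assms(2) by (intro ext transformed_density_eq_link_deriv)
  ultimately show ?thesis
    by metis
qed

end

section \<open>Monotonicity of the odds rate\<close>

text \<open>The factor \<open>(1 - G x)\<^sup>2\<close> of the density cancels the denominator of
  the odds rate, leaving a product in which \<open>G\<close> no longer occurs.\<close>

lemma odds_rate_transformed_density:
  assumes "F x < 1" and "G x < 1"
  shows "odds_rate G (transformed_density \<alpha> \<beta> \<theta> F f G) x
    = \<beta> * \<theta> * (\<alpha> + F x / (1 - F x)) powr (\<theta> - 1) * odds_rate F f x"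
  using assms by (simp add: odds_rate_def transformed_density_def odds_def)

theorem theorem4p6:
  fixes F f G :: "real \<Rightarrow> real" and \<alpha> \<beta> \<theta> :: real
  assumes "distribution_function F" and "has_density F f"
    and "\<alpha> \<ge> 0" and "\<beta> > 0" and "\<theta> > 0"
    and "distribution_function G"
    and "\<forall>x. odds G x = transformed_odds \<alpha> \<beta> \<theta> F x"
  shows "(\<theta> \<ge> 1 \<and> increasing_odds_rate F f \<longrightarrow>
            increasing_odds_rate G (transformed_density \<alpha> \<beta> \<theta> F f G))
       \<and> (\<theta> \<le> 1 \<and> decreasing_odds_rate F f \<longrightarrow>
            decreasing_odds_rate G (transformed_density \<alpha> \<beta> \<theta> F f G))"
proof -
  note par = \<open>\<alpha> \<ge> 0\<close> \<open>\<beta> > 0\<close> \<open>\<theta> > 0\<close>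
  have G: "G x = odds_link \<alpha> \<beta> \<theta> (F x)" for x
    using odds_eq_transformed_odds_imp_link[OF par] assms(7) by blast
  have dens: "has_density G (transformed_density \<alpha> \<beta> \<theta> F f G)"
    using has_density_transformed[OF par assms(2) G] .
  obtain M where "real_distribution M" and FM: "F = cdf M"
    using assms(1) by (auto simp: distribution_function_def)
  then interpret real_distribution M by simp
  have F01: "0 \<le> F x" "F x \<le> 1" and F_mono: "x \<le> y \<Longrightarrow> F x \<le> F y" for x y
    unfolding FM by (auto simp: cdf_nonneg cdf_bounded_prob cdf_nondecreasing)
  \<comment> \<open>The link fixes 0 and 1, so the support of \<open>G\<close> lies in that of
    \<open>F\<close>, where the hypothesis on \<open>F\<close> applies.\<close>
  have supp: "0 < F x \<and> F x < 1" if "0 < G x" "G x < 1" for x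
    using that F01[of x] G[of x] odds_link_0[OF par] odds_link_1[OF par]
    by (cases "F x = 0 \<or> F x = 1") auto
  have f_nonneg: "0 \<le> odds_rate F f x" for x
    using assms(2) by (auto simp: has_density_def odds_rate_def)
  \<comment> \<open>The base is strictly positive even for \<alpha> = 0, because
    \<open>F x > 0\<close>; the nonpositive exponent \<theta> - 1 of the decreasing case requires
    this.\<close>
  have odds_le: "\<alpha> + F x / (1 - F x) \<le> \<alpha> + F y / (1 - F y)"
    and odds_pos: "0 < \<alpha> + F x / (1 - F x)"
    if "0 < F x" "F y < 1" "x \<le> y" for x y
    using that F_mono[of x y] par by (auto intro!: frac_le add_nonneg_pos)

  show ?thesis
  proof (intro conjI impI; elim conjE)
    assume "\<theta> \<ge> 1" and inc: "increasing_odds_rate F f"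
    have "mono_on {x. 0 < G x \<and> G x < 1} (odds_rate G (transformed_density \<alpha> \<beta> \<theta> F f G))"
    proof (rule mono_onI)
      fix x y assume "x \<in> {x. 0 < G x \<and> G x < 1}" "y \<in> {x. 0 < G x \<and> G x < 1}" "x \<le> y"
      then have xy: "0 < F x" "F x < 1" "0 < F y" "F y < 1" "G x < 1" "G y < 1" "x \<le> y"
        using supp by auto
      moreover have "odds_rate F f x \<le> odds_rate F f y"
        using inc xy by (auto simp: increasing_odds_rate_def monotone_on_def)
      moreover have "(\<alpha> + F x / (1 - F x)) powr (\<theta> - 1) \<le> (\<alpha> + F y / (1 - F y)) powr (\<theta> - 1)"
        using \<open>\<theta> \<ge> 1\<close> odds_le[of x y] odds_pos[of x y] xy by (intro powr_mono2) auto
      ultimately show "odds_rate G (transformed_density \<alpha> \<beta> \<theta> F f G) x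
          \<le> odds_rate G (transformed_density \<alpha> \<beta> \<theta> F f G) y"
        using par f_nonneg by (simp add: odds_rate_transformed_density mult_mono)
    qed
    then show "increasing_odds_rate G (transformed_density \<alpha> \<beta> \<theta> F f G)"
      using dens by (simp add: increasing_odds_rate_def)
  next
    assume "\<theta> \<le> 1" and dec: "decreasing_odds_rate F f"
    have "antimono_on {x. 0 < G x \<and> G x < 1} (odds_rate G (transformed_density \<alpha> \<beta> \<theta> F f G))"
    proof (rule monotone_onI)
      fix x y assume "x \<in> {x. 0 < G x \<and> G x < 1}" "y \<in> {x. 0 < G x \<and> G x < 1}" "x \<le> y"
      then have xy: "0 < F x" "F x < 1" "0 < F y" "F y < 1" "G x < 1" "G y < 1" "x \<le> y"
        using supp by auto
      moreover have "odds_rate F f y \<le> odds_rate F f x"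
        using dec xy by (auto simp: decreasing_odds_rate_def monotone_on_def)
      \<comment> \<open>The exponent is now at most 0, so the power reverses the order and both
        factors decrease.\<close>
      moreover have "(\<alpha> + F y / (1 - F y)) powr (\<theta> - 1) \<le> (\<alpha> + F x / (1 - F x)) powr (\<theta> - 1)"
        using \<open>\<theta> \<le> 1\<close> odds_le[of x y] odds_pos[of x y] xy by (intro powr_mono2') auto
      ultimately show "odds_rate G (transformed_density \<alpha> \<beta> \<theta> F f G) x
          \<ge> odds_rate G (transformed_density \<alpha> \<beta> \<theta> F f G) y"
        using par f_nonneg by (simp add: odds_rate_transformed_density mult_mono)
    qed
    then show "decreasing_odds_rate G (transformed_density \<alpha> \<beta> \<theta> F f G)"
      using dens by (simp add: decreasing_odds_rate_def)
  qed
qed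

end
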